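(* Let $c\in\mathbb{R}$ and let $W$ be a discontinuous profile function (that is, a profile function with $W(0-)\neq W(0+)$). Then the traveling wave $u(x,t)=W(x-ct)$ is a weak solution of the Cauchy problem for the Fornberg-Whitham equation $u_t+uu_x+K\ast u_x=0$, $u(x,0)=u_0(x)$, with initial value $u_0=W$, if and only if $W$ satisfies both the Rankine-Hugoniot condition $$W(0+)+W(0-)=2c$$ and the integro-differential equation $$(W(\xi)-c)\,W'(\xi)+(K'\ast W)(\xi)=0\qquad\text{for all }\xi\neq0.$$
   Context: The kernel is $K(x)=\frac12 e^{-|x|}$ on $\mathbb{R}$, and $K'(x)=-\frac12\,\mathrm{sgn}(x)e^{-|x|}$. Convolutions are in the spatial variable only. Weak solution: a function $u\in L^\infty_{\mathrm{loc}}(\mathbb{R}\times[0,\infty))$ is a weak solution of the Cauchy problem $u_t+uu_x+K\ast u_x=0$, $u(\cdot,0)=u_0$, with $u_0\in L^\infty_{\mathrm{loc}}(\mathbb{R})$, if $$\int_0^\infty\int_{-\infty}^\infty\Big(-u(x,t)\,\partial_t\phi(x,t)-\frac{u^2(x,t)}{2}\,\partial_x\phi(x,t)+\big(K'\ast u(\cdot,t)\big)(x)\,\phi(x,t)\Big)\,dx\,dt=\int_{-\infty}^\infty u_0(x)\,\phi(x,0)\,dx$$ for every test function $\phi\in C_c^\infty(\mathbb{R}^2)$. Profile function: a function $W\colon\mathbb{R}\to\mathbb{R}$ which is $C^2$ on $\mathbb{R}\setminus\{0\}$, such that $W,W',W''$ possess (finite) one-sided limits at $0$, and such that there are $A,B\in\mathbb{R}$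 with $\lim_{\xi\to-\infty}W(\xi)=A$ and $\lim_{\xi\to+\infty}W(\xi)=B$. $W(0\pm)$ denote the one-sided limits at $0$. *)

theory Defs
  imports "HOL-Analysis.Analysis"
begin

(* The a.e. derivative of exp (-|x|) / 2; the value at the kink 0 is sgn 0 = 0. *)
definition K' :: "real \<Rightarrow> real"
  where "K' x = - (1 / 2) * sgn x * exp (- \<bar>x\<bar>)"

definition convolution_exists :: "(real \<Rightarrow> real) \<Rightarrow> (real \<Rightarrow> real) \<Rightarrow> real \<Rightarrow> bool"
  where "convolution_exists f g x \<longleftrightarrow> integrable lebesgue (\<lambda>y. f (x - y) * g y)"

definition convolve :: "(real \<Rightarrow> real) \<Rightarrow> (real \<Rightarrow> real) \<Rightarrow> real \<Rightarrow> real"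
  where "convolve f g x = (LINT y|lebesgue. f (x - y) * g y)"

(* Quantifying over the compact subsets of S itself makes the functions in
   L^infinity_loc (R x [0,infinity)) essentially bounded up to t = 0. *)
definition Linf_loc :: "'a::euclidean_space set \<Rightarrow> ('a \<Rightarrow> real) set"
  where "Linf_loc S = {f. f \<in> borel_measurable (lebesgue_on S) \<and>
           (\<forall>C. compact C \<and> C \<subseteq> S \<longrightarrow> (\<exists>M. AE z in lebesgue_on C. \<bar>f z\<bar> \<le> M))}"

definition partial_x :: "(real \<times> real \<Rightarrow> real) \<Rightarrow> real \<times> real \<Rightarrow> real"
  where "partial_x \<phi> = (\<lambda>(x, t). deriv (\<lambda>y. \<phi> (y, t)) x)"

definition partial_t :: "(real \<times> real \<Rightarrow> real) \<Rightarrow> real \<times> real \<Rightarrow> real"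
  where "partial_t \<phi> = (\<lambda>(x, t). deriv (\<lambda>s. \<phi> (x, s)) t)"

primrec Ck_fun :: "nat \<Rightarrow> (real \<times> real \<Rightarrow> real) \<Rightarrow> bool"
  where
    "Ck_fun 0 \<phi> \<longleftrightarrow> continuous_on UNIV \<phi>"
  | "Ck_fun (Suc k) \<phi> \<longleftrightarrow>
       (\<forall>p. \<phi> differentiable (at p)) \<and> Ck_fun k (partial_x \<phi>) \<and> Ck_fun k (partial_t \<phi>)"

definition test_function :: "(real \<times> real \<Rightarrow> real) \<Rightarrow> bool"
  where "test_function \<phi> \<longleftrightarrow> (\<forall>k. Ck_fun k \<phi>) \<and> compact (closure {p. \<phi> p \<noteq> 0})"

definition weak_integrand ::
    "(real \<Rightarrow> real \<Rightarrow> real) \<Rightarrow> (real \<times> real \<Rightarrow> real) \<Rightarrow> real \<Rightarrow> real \<Rightarrow> real"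
  where "weak_integrand u \<phi> x t =
     - u x t * partial_t \<phi> (x, t) - (u x t)\<^sup>2 / 2 * partial_x \<phi> (x, t)
     + convolve K' (\<lambda>y. u y t) x * \<phi> (x, t)"

(* The argument order is u x t; only the values for t >= 0 matter. For a general u in
   L^infinity_loc the convolution K' * u(., t) may diverge, and Bochner integrals of
   non-integrable functions are 0 by convention. The third and the fourth condition
   therefore say explicitly that the integrals in the weak formulation exist. *)
definition weak_solution :: "(real \<Rightarrow> real \<Rightarrow> real) \<Rightarrow> (real \<Rightarrow> real) \<Rightarrow> bool"
  where "weak_solution u u0 \<longleftrightarrow>
     (\<lambda>(x, t). u x t) \<in> Linf_loc (UNIV \<times> {0..}) \<and>
     u0 \<in> Linf_loc UNIV \<and>
     (AE (x, t) in lebesgue_on (UNIV \<times> {0..}). convolution_exists K' (\<lambda>y. u y t) x) \<and>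
     (\<forall>\<phi>. test_function \<phi> \<longrightarrow>
        set_integrable lebesgue (UNIV \<times> {0..}) (\<lambda>(x, t). weak_integrand u \<phi> x t) \<and>
        (LINT t:{0..}|lebesgue. LINT x|lebesgue. weak_integrand u \<phi> x t)
          = (LINT x|lebesgue. u0 x * \<phi> (x, 0)))"

(* Neither W 0 nor the (possibly meaningless) values of deriv W and deriv (deriv W) at 0
   are constrained: the one-sided limits at 0 ignore them. *)
definition profile_function :: "(real \<Rightarrow> real) \<Rightarrow> bool"
  where "profile_function W \<longleftrightarrow>
     (\<forall>\<xi>. \<xi> \<noteq> 0 \<longrightarrow> W differentiable (at \<xi>) \<and> deriv W differentiable (at \<xi>)) \<and>
     continuous_on (- {0}) (deriv (deriv W)) \<and>
     (\<forall>f \<in> {W, deriv W, deriv (deriv W)}.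
        (\<exists>l. (f \<longlongrightarrow> l) (at_left 0)) \<and> (\<exists>l. (f \<longlongrightarrow> l) (at_right 0))) \<and>
     (\<exists>A. (W \<longlongrightarrow> A) at_bot) \<and> (\<exists>B. (W \<longlongrightarrow> B) at_top)"

abbreviation lim_left0 :: "(real \<Rightarrow> real) \<Rightarrow> real"
  where "lim_left0 W \<equiv> Lim (at_left 0) W"

abbreviation lim_right0 :: "(real \<Rightarrow> real) \<Rightarrow> real"
  where "lim_right0 W \<equiv> Lim (at_right 0) W"

end

theory Submission
  imports Defs
begin

text \<open>
  In the frame \<open>\<xi> = x - c t\<close> of the wave, a test function \<open>\<phi>\<close> becomes
  \<open>\<psi> (\<xi>, t) = \<phi> (\<xi> + c t, t)\<close>, and \<open>\<partial>\<^sub>t \<phi> = \<partial>\<^sub>t \<psi> - c \<partial>\<^sub>\<xi> \<psi>\<close>. The weak integrand turns into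
  \<open>- W \<partial>\<^sub>t \<psi> + (c W - W\<^sup>2 / 2) \<partial>\<^sub>\<xi> \<psi> + (K' * W) \<psi>\<close>, whose coefficients depend on \<open>\<xi>\<close> only.
  By Fubini and the fundamental theorem in \<open>t\<close>, the first term produces exactly the initial datum
  \<open>\<integral> W \<phi>(\<cdot>, 0)\<close> (\<open>time_integral_initial_value\<close>). Integrating the second term by parts on each of
  the half lines \<open>\<xi> < 0\<close> and \<open>\<xi> > 0\<close> (\<open>integral_half_lines_by_parts\<close>) leaves a boundary term at the
  jump, the jump of the flux \<open>c W - W\<^sup>2 / 2\<close> times \<open>\<psi> (0, t)\<close>, and adds \<open>(W - c) W'\<close> to the
  coefficient of \<open>\<psi>\<close>. Hence the travelling wave is a weak solution if and only if
  \<open>\<integral>\<^sub>0\<^sup>\<infinity> (J \<psi> (0, t) + \<integral> h \<psi> (\<xi>, t) d\<xi>) dt = 0\<close> for all \<open>\<phi>\<close>, where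
  \<open>J = (W(0-) - W(0+)) (c - (W(0-) + W(0+)) / 2)\<close> and \<open>h = (W - c) W' + K' * W\<close>
  (\<open>weak_solution_iff_defects\<close>).

  Since \<open>W(0-) \<noteq> W(0+)\<close>, the Rankine-Hugoniot condition says \<open>J = 0\<close>, and the integro-differential
  equation says \<open>h = 0\<close> off \<open>0\<close>; so both together give a weak solution at once. Conversely,
  \<open>\<phi> (x, t) = a (x - c t) b (t)\<close> with smooth bumps \<open>a\<close> and \<open>b\<close> separates the variables and yields
  \<open>J a(0) + \<integral> h a = 0\<close> for every bump \<open>a\<close>. Bumps supported near a point \<open>\<xi>\<^sub>0 \<noteq> 0\<close> give
  \<open>h (\<xi>\<^sub>0) = 0\<close>, because \<open>h\<close> is continuous there; a bump with \<open>a(0) > 0\<close> then gives \<open>J = 0\<close>.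
\<close>

section \<open>Smooth bump functions\<close>

text \<open>
  The classical function \<open>exp (- 1 / x)\<close> that is flat at \<open>0\<close>. Dividing by all powers of \<open>x\<close> gives a
  family whose derivatives are linear combinations of its members, so that smoothness of every
  member follows from one derivative formula.
\<close>

definition flat :: "nat \<Rightarrow> real \<Rightarrow> real"
  where "flat k x = (if x > 0 then exp (- (1 / x)) / x ^ k else 0)"

lemma flat_nonneg: "flat k x \<ge> 0"
  by (simp add: flat_def)

lemma flat_pos_iff: "flat k x > 0 \<longleftrightarrow> x > 0"
  by (simp add: flat_def)

lemma flat_eq_0_iff: "flat k x = 0 \<longleftrightarrow> x \<le> 0"
  by (auto simp: flat_def)

lemma flat_tendsto_0: "(flat k \<longlongrightarrow> 0) (at 0)"
proof -
  have "((\<lambda>x. inverse x ^ k / exp (inverse x)) \<longlongrightarrow> (0::real)) (at_right 0)"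
    by (rule filterlim_compose[OF tendsto_power_div_exp_0 filterlim_inverse_at_top_right])
  moreover have "\<forall>\<^sub>F x in at_right 0. inverse x ^ k / exp (inverse x) = flat k x"
    by (rule eventually_mono[OF eventually_at_right_less])
      (simp add: flat_def exp_minus field_simps)
  ultimately have "(flat k \<longlongrightarrow> 0) (at_right 0)"
    by (rule Lim_transform_eventually)
  moreover have "(flat k \<longlongrightarrow> 0) (at_left 0)"
    by (rule Lim_transform_eventually[OF tendsto_const], rule eventually_at_leftI[of "-1"])
      (auto simp: flat_def)
  ultimately show ?thesis
    by (simp add: filterlim_at_split)
qed

text \<open>
  At \<open>0\<close> the difference quotient of \<open>flat k\<close> is \<open>flat (k + 1)\<close> itself, which tends to \<open>0\<close>.
\<close>

lemma flat_deriv: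
  "(flat k has_field_derivative flat (k + 2) x - real k * flat (k + 1) x) (at x)"
proof (cases x "0::real" rule: linorder_cases)
  case less
  have "((\<lambda>_. 0) has_field_derivative 0) (at x)"
    by simp
  then have "(flat k has_field_derivative 0) (at x)"
    by (rule has_field_derivative_transform_within_open[where S="{..<0}"])
      (use less in \<open>auto simp: flat_def\<close>)
  with less show ?thesis
    by (simp add: flat_def)
next
  case equal
  have "(\<lambda>h. (flat k (0 + h) - flat k 0) / h) = flat (k + 1)"
    by (auto simp: flat_def fun_eq_iff)
  then have "(flat k has_field_derivative 0) (at 0)"
    using flat_tendsto_0[of "k + 1"] by (simp only: DERIV_def)
  with equal show ?thesis
    by (simp add: flat_def)
next
  case greater
  have "((\<lambda>x. exp (- (1 / x)) / x ^ k) has_field_derivative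
      flat (k + 2) x - real k * flat (k + 1) x) (at x)"
    using greater
    by (cases "k = 0"; cases "k = 1"; cases k)
      (auto intro!: derivative_eq_intros simp: flat_def field_simps power2_eq_square gr0_conv_Suc)
  then show ?thesis
    by (rule has_field_derivative_transform_within_open[where S="{0<..}"])
      (use greater in \<open>auto simp: flat_def\<close>)
qed

lemma partials_of_has_derivative:
  assumes D: "(\<phi> has_derivative D) (at (x, t))"
  shows "partial_x \<phi> (x, t) = D (1, 0)" "partial_t \<phi> (x, t) = D (0, 1)"
proof -
  have lin1: "D (h, 0) = D (1, 0) * h" and lin2: "D (0, h) = D (0, 1) * h" for h
    using linear_scale[OF has_derivative_linear[OF D], of h "(1, 0)"]
      linear_scale[OF has_derivative_linear[OF D], of h "(0, 1)"]
    by (simp_all add: mult.commute)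
  have "((\<lambda>y. (y, t)) has_derivative (\<lambda>h. (h, 0))) (at x)"
    by (auto intro!: derivative_eq_intros)
  from has_derivative_compose[OF this D]
  have "((\<lambda>y. \<phi> (y, t)) has_field_derivative D (1, 0)) (at x)"
    unfolding has_field_derivative_def
    by (rule has_derivative_eq_rhs) (rule ext, rule lin1)
  then show "partial_x \<phi> (x, t) = D (1, 0)"
    by (simp add: partial_x_def DERIV_imp_deriv)
  have "((\<lambda>s. (x, s)) has_derivative (\<lambda>h. (0, h))) (at t)"
    by (auto intro!: derivative_eq_intros)
  from has_derivative_compose[OF this D]
  have "((\<lambda>s. \<phi> (x, s)) has_field_derivative D (0, 1)) (at t)"
    unfolding has_field_derivative_def
    by (rule has_derivative_eq_rhs) (rule ext, rule lin2)
  then show "partial_t \<phi> (x, t) = D (0, 1)"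
    by (simp add: partial_t_def DERIV_imp_deriv)
qed

text \<open>
  An algebra of functions on the plane that is closed under both partial derivatives. The Leibniz
  rule is needed for first derivatives only; iterating the closure gives derivatives of all orders.
\<close>

inductive_set smooth_algebra :: "(real \<times> real \<Rightarrow> real) set"
  where
    const: "(\<lambda>_. a) \<in> smooth_algebra"
  | flat_affine: "(\<lambda>p. flat k (\<alpha> * fst p + \<beta> * snd p + \<gamma>)) \<in> smooth_algebra"
  | add: "f \<in> smooth_algebra \<Longrightarrow> g \<in> smooth_algebra \<Longrightarrow> (\<lambda>p. f p + g p) \<in> smooth_algebra"
  | mult: "f \<in> smooth_algebra \<Longrightarrow> g \<in> smooth_algebra \<Longrightarrow> (\<lambda>p. f p * g p) \<in> smooth_algebra"

lemma smooth_algebra_derivative: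
  assumes "f \<in> smooth_algebra"
  shows "\<exists>fx\<in>smooth_algebra. \<exists>ft\<in>smooth_algebra.
    \<forall>x t. (f has_derivative (\<lambda>(h, k). fx (x, t) * h + ft (x, t) * k)) (at (x, t))"
  using assms
proof induction
  case (const a)
  then show ?case
    by (intro bexI[of _ "\<lambda>_. 0"] smooth_algebra.const) (auto simp: case_prod_beta)
next
  case (flat_affine k \<alpha> \<beta> \<gamma>)
  let ?l = "\<lambda>p::real \<times> real. \<alpha> * fst p + \<beta> * snd p + \<gamma>"
  define d where "d p = flat (k + 2) (?l p) + (- real k) * flat (k + 1) (?l p)" for p
  have d: "d \<in> smooth_algebra"
    unfolding d_def by (intro smooth_algebra.intros)
  have "((\<lambda>p. flat k (?l p)) has_derivative (\<lambda>h. (\<alpha> * fst h + \<beta> * snd h) * d q)) (at q)" for q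
  proof (rule has_derivative_compose[where f="?l" and g="flat k"
        and f'="\<lambda>h. \<alpha> * fst h + \<beta> * snd h" and g'="\<lambda>h. h * d q"])
    show "(?l has_derivative (\<lambda>h. \<alpha> * fst h + \<beta> * snd h)) (at q)"
      by (auto intro!: derivative_eq_intros)
    show "(flat k has_derivative (\<lambda>h. h * d q)) (at (?l q))"
      by (rule has_derivative_eq_rhs[OF flat_deriv[unfolded has_field_derivative_def]])
        (auto simp: d_def fun_eq_iff)
  qed
  then show ?case
    using d by (intro bexI[of _ "\<lambda>p. \<alpha> * d p"] bexI[of _ "\<lambda>p. \<beta> * d p"])
      (auto intro: smooth_algebra.intros simp: case_prod_beta algebra_simps)
next
  case (add f g)
  then obtain fx ft gx gt where *: "fx \<in> smooth_algebra" "ft \<in> smooth_algebra"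
      "gx \<in> smooth_algebra" "gt \<in> smooth_algebra"
    and f: "\<And>x t. (f has_derivative (\<lambda>(h, k). fx (x, t) * h + ft (x, t) * k)) (at (x, t))"
    and g: "\<And>x t. (g has_derivative (\<lambda>(h, k). gx (x, t) * h + gt (x, t) * k)) (at (x, t))"
    by blast
  show ?case
    using * by (intro bexI[of _ "\<lambda>p. fx p + gx p"] bexI[of _ "\<lambda>p. ft p + gt p"] allI
        has_derivative_eq_rhs[OF has_derivative_add[OF f g]])
      (auto intro: smooth_algebra.intros simp: case_prod_beta algebra_simps)
next
  case (mult f g)
  then obtain fx ft gx gt where *: "fx \<in> smooth_algebra" "ft \<in> smooth_algebra"
      "gx \<in> smooth_algebra" "gt \<in> smooth_algebra"
    and f: "\<And>x t. (f has_derivative (\<lambda>(h, k). fx (x, t) * h + ft (x, t) * k)) (at (x, t))"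
    and g: "\<And>x t. (g has_derivative (\<lambda>(h, k). gx (x, t) * h + gt (x, t) * k)) (at (x, t))"
    by blast
  show ?case
    using * mult.hyps
    by (intro bexI[of _ "\<lambda>p. f p * gx p + fx p * g p"] bexI[of _ "\<lambda>p. f p * gt p + ft p * g p"] allI
        has_derivative_eq_rhs[OF has_derivative_mult[OF f g]])
      (auto intro!: smooth_algebra.intros simp: case_prod_beta algebra_simps)
qed

lemma smooth_algebra_Ck: "f \<in> smooth_algebra \<Longrightarrow> Ck_fun k f"
proof (induction k arbitrary: f)
  case (0 f)
  then show ?case
    using smooth_algebra_derivative[OF 0]
    by (force intro!: continuous_at_imp_continuous_on has_derivative_continuous)
next
  case (Suc k f)
  from smooth_algebra_derivative[OF Suc.prems]
  obtain fx ft where *: "fx \<in> smooth_algebra" "ft \<in> smooth_algebra"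
    and f: "\<And>x t. (f has_derivative (\<lambda>(h, k). fx (x, t) * h + ft (x, t) * k)) (at (x, t))"
    by blast
  have "partial_x f = fx" "partial_t f = ft"
    using partials_of_has_derivative[OF f] by auto
  moreover have "f differentiable (at p)" for p
    using f[of "fst p" "snd p"] unfolding differentiable_def by auto
  ultimately show ?case
    using * Suc.IH by simp
qed

definition bump :: "real \<Rightarrow> real \<Rightarrow> real \<Rightarrow> real"
  where "bump l r x = flat 0 (x - l) * flat 0 (r - x)"

lemma bump_pos_iff: "bump l r x > 0 \<longleftrightarrow> l < x \<and> x < r"
  using flat_nonneg[of 0 "x - l"] by (auto simp: bump_def zero_less_mult_iff flat_pos_iff)

lemma bump_eq_0_iff: "bump l r x = 0 \<longleftrightarrow> x \<le> l \<or> r \<le> x"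
  by (auto simp: bump_def flat_eq_0_iff)

lemma continuous_on_bump [continuous_intros]: "continuous_on S (bump l r)"
proof -
  have c: "continuous_on UNIV (flat 0)"
    using flat_deriv by (intro continuous_at_imp_continuous_on ballI DERIV_isCont)
  show ?thesis
    unfolding bump_def
    by (intro continuous_intros continuous_on_compose2[OF c]) auto
qed

text \<open>
  The test functions that separate the variables in the frame moving with speed \<open>c\<close>.
\<close>

lemma test_function_travelling_bump:
  "test_function (\<lambda>(x, t). bump l r (x - c * t) * bump l' r' t)"
proof -
  have "(\<lambda>p. flat 0 (1 * fst p + (- c) * snd p + (- l)) * flat 0 ((-1) * fst p + c * snd p + r) *
      (flat 0 (0 * fst p + 1 * snd p + (- l')) * flat 0 (0 * fst p + (-1) * snd p + r')))
    \<in> smooth_algebra"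
    by (intro smooth_algebra.intros)
  then have "(\<lambda>(x, t). bump l r (x - c * t) * bump l' r' t) \<in> smooth_algebra"
    by (rule back_subst[where P="\<lambda>f. f \<in> smooth_algebra"])
      (auto simp: bump_def fun_eq_iff intro!: arg_cong2[where f="(*)"] arg_cong[where f="flat 0"])
  moreover
  let ?S = "(\<lambda>(\<xi>, t). (\<xi> + c * t, t)) ` ({l..r} \<times> {l'..r'})"
  have "compact ?S"
    by (intro compact_continuous_image compact_Times)
      (auto intro!: continuous_intros simp: case_prod_beta)
  moreover have "{p. (\<lambda>(x, t). bump l r (x - c * t) * bump l' r' t) p \<noteq> 0} \<subseteq> ?S"
  proof clarsimp
    fix x t assume "bump l r (x - c * t) \<noteq> 0" "bump l' r' t \<noteq> 0"
    then show "(x, t) \<in> ?S"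
      by (intro image_eqI[of _ _ "(x - c * t, t)"]) (auto simp: bump_eq_0_iff)
  qed
  ultimately show ?thesis
    unfolding test_function_def compact_closure
    by (blast intro: smooth_algebra_Ck bounded_subset[OF compact_imp_bounded])
qed

section \<open>Profile functions and their convolution with the kernel\<close>

lemma integrable_bounded_support:
  fixes f :: "'a::euclidean_space \<Rightarrow> real"
  assumes "f \<in> borel_measurable borel" "bounded S"
    and "\<And>x. x \<in> S \<Longrightarrow> \<bar>f x\<bar> \<le> M" "\<And>x. x \<notin> S \<Longrightarrow> f x = 0"
  shows "integrable lborel f"
proof -
  obtain R where R: "\<And>x. x \<in> S \<Longrightarrow> norm x \<le> R"
    using \<open>bounded S\<close> unfolding bounded_iff by metis
  show ?thesis
  proof (rule integrableI_bounded_set)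
    show "f \<in> borel_measurable lborel" "cball 0 R \<in> sets lborel"
      using assms(1) by simp_all
    show "emeasure lborel (cball (0::'a) R) < \<infinity>"
      by (rule emeasure_lborel_cball_finite)
    show "AE x in lborel. x \<notin> cball 0 R \<longrightarrow> f x = 0"
    proof (intro AE_I2 impI)
      fix x :: 'a assume "x \<notin> cball 0 R"
      then show "f x = 0"
        using R[of x] assms(4)[of x] by (cases "x \<in> S") simp_all
    qed
    show "AE x in lborel. x \<in> cball 0 R \<longrightarrow> norm (f x) \<le> \<bar>M\<bar>"
    proof (intro AE_I2 impI)
      fix x
      show "norm (f x) \<le> \<bar>M\<bar>"
        using assms(3)[of x] assms(4)[of x] by (cases "x \<in> S") simp_all
    qed
  qed
qed

text \<open>
  One-sided limits bound \<open>f\<close> on a punctured neighbourhood of \<open>0\<close>, compactness bounds it on the rest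
  of the interval, and the point \<open>0\<close> contributes the single value \<open>f 0\<close>.
\<close>

lemma bounded_near_one_sided_limits:
  fixes f :: "real \<Rightarrow> real"
  assumes cont: "continuous_on (- {0}) f"
    and l: "(f \<longlongrightarrow> l) (at_left 0)" and r: "(f \<longlongrightarrow> r) (at_right 0)"
  shows "\<exists>M. \<forall>x\<in>{-R..R}. \<bar>f x\<bar> \<le> M"
proof -
  have "\<forall>\<^sub>F x in at_left 0. f x \<in> ball l 1"
    using tendstoD[OF l zero_less_one] by (simp add: dist_commute)
  then obtain a where a: "a < 0" "\<And>x. a < x \<Longrightarrow> x < 0 \<Longrightarrow> f x \<in> ball l 1"
    unfolding eventually_at_left_field by blast
  have "\<forall>\<^sub>F x in at_right 0. f x \<in> ball r 1"
    using tendstoD[OF r zero_less_one] by (simp add: dist_commute)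
  then obtain b where b: "0 < b" "\<And>x. 0 < x \<Longrightarrow> x < b \<Longrightarrow> f x \<in> ball r 1"
    unfolding eventually_at_right_field by blast
  have "compact (f ` ({-R..a} \<union> {b..R}))"
    using a(1) b(1)
    by (intro compact_continuous_image continuous_on_subset[OF cont] compact_Un) auto
  then have "bounded (f ` ({-R..a} \<union> {b..R}) \<union> ball l 1 \<union> ball r 1 \<union> {f 0})"
    by (auto dest: compact_imp_bounded)
  then have "bounded (f ` {-R..R})"
  proof (rule bounded_subset, intro image_subsetI)
    fix x assume x: "x \<in> {-R..R}"
    consider "x \<le> a" | "a < x" "x < 0" | "x = 0" | "0 < x" "x < b" | "b \<le> x"
      by linarith
    then show "f x \<in> f ` ({-R..a} \<union> {b..R}) \<union> ball l 1 \<union> ball r 1 \<union> {f 0}"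
    proof cases
      case 1
      then have "f x \<in> f ` ({-R..a} \<union> {b..R})"
        using x by (intro imageI) auto
      then show ?thesis by blast
    next
      case 2
      then show ?thesis using a(2) by blast
    next
      case 3
      then show ?thesis by blast
    next
      case 4
      then show ?thesis using b(2) by blast
    next
      case 5
      then have "f x \<in> f ` ({-R..a} \<union> {b..R})"
        using x by (intro imageI) auto
      then show ?thesis by blast
    qed
  qed
  then show ?thesis
    by (auto simp: bounded_iff)
qed

lemma
  assumes "profile_function W"
  shows profile_DERIV: "\<xi> \<noteq> 0 \<Longrightarrow> (W has_field_derivative deriv W \<xi>) (at \<xi>)"
    and profile_isCont: "\<xi> \<noteq> 0 \<Longrightarrow> isCont W \<xi>"
    and profile_deriv_isCont: "\<xi> \<noteq> 0 \<Longrightarrow> isCont (deriv W) \<xi>"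
    and profile_continuous_on: "continuous_on (- {0}) W"
    and profile_deriv_continuous_on: "continuous_on (- {0}) (deriv W)"
    and profile_tendsto_left: "(W \<longlongrightarrow> lim_left0 W) (at_left 0)"
    and profile_tendsto_right: "(W \<longlongrightarrow> lim_right0 W) (at_right 0)"
proof -
  have d: "\<xi> \<noteq> 0 \<Longrightarrow> W differentiable (at \<xi>) \<and> deriv W differentiable (at \<xi>)" for \<xi>
    using assms by (auto simp: profile_function_def)
  show "\<xi> \<noteq> 0 \<Longrightarrow> (W has_field_derivative deriv W \<xi>) (at \<xi>)" for \<xi>
    using d[of \<xi>] by (simp add: DERIV_deriv_iff_real_differentiable)
  show c1: "\<xi> \<noteq> 0 \<Longrightarrow> isCont W \<xi>" and c2: "\<xi> \<noteq> 0 \<Longrightarrow> isCont (deriv W) \<xi>" for \<xi>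
    using d[of \<xi>] by (auto simp: differentiable_imp_continuous_within)
  show "continuous_on (- {0}) W" "continuous_on (- {0}) (deriv W)"
    using c1 c2 by (auto intro: continuous_at_imp_continuous_on)
  show "(W \<longlongrightarrow> lim_left0 W) (at_left 0)" "(W \<longlongrightarrow> lim_right0 W) (at_right 0)"
    using assms tendsto_Lim[OF trivial_limit_at_left_real] tendsto_Lim[OF trivial_limit_at_right_real]
    by (fastforce simp: profile_function_def)+
qed

lemma profile_measurable:
  assumes "profile_function W"
  shows "W \<in> borel_measurable borel" "deriv W \<in> borel_measurable borel"
  by (rule borel_measurable_continuous_countable_exceptions[of "{0}"];
      simp add: profile_continuous_on[OF assms] profile_deriv_continuous_on[OF assms])+

lemma profile_bounded:
  assumes "profile_function W"
  shows "\<exists>M. \<forall>\<xi>. \<bar>W \<xi>\<bar> \<le> M"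
proof -
  obtain A B where A: "(W \<longlongrightarrow> A) at_bot" and B: "(W \<longlongrightarrow> B) at_top"
    using assms by (auto simp: profile_function_def)
  obtain a where a: "\<And>\<xi>. \<xi> \<le> a \<Longrightarrow> dist (W \<xi>) A < 1"
    using tendstoD[OF A zero_less_one] by (auto simp: eventually_at_bot_linorder)
  obtain b where b: "\<And>\<xi>. b \<le> \<xi> \<Longrightarrow> dist (W \<xi>) B < 1"
    using tendstoD[OF B zero_less_one] by (auto simp: eventually_at_top_linorder)
  define R where "R = \<bar>a\<bar> + \<bar>b\<bar>"
  obtain M where M: "\<forall>\<xi>\<in>{-R..R}. \<bar>W \<xi>\<bar> \<le> M"
    using bounded_near_one_sided_limits[OF profile_continuous_on profile_tendsto_left
        profile_tendsto_right] assms by blast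
  have "\<bar>W \<xi>\<bar> \<le> \<bar>M\<bar> + \<bar>A\<bar> + \<bar>B\<bar> + 1" for \<xi>
  proof -
    consider "\<xi> \<le> a" | "b \<le> \<xi>" | "\<xi> \<in> {-R..R}"
      unfolding R_def by fastforce
    then show ?thesis
      by cases (use a[of \<xi>] b[of \<xi>] M[rule_format, of \<xi>] in \<open>auto simp: dist_real_def\<close>)
  qed
  then show ?thesis
    by blast
qed

lemma K'_measurable [measurable]: "K' \<in> borel_measurable borel"
  unfolding K'_def by measurable

lemma K'_integrable: "integrable lborel K'"
proof -
  have "set_integrable lebesgue {0..} (\<lambda>x::real. exp (- 1 * x))"
    by (intro nonnegative_absolutely_integrable_1 integrable_on_exp_minus_to_infinity) auto
  \<comment> \<open>The absolute value of the kernel is dominated by the sum of its two exponential tails.\<close>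
  then have pos: "integrable lborel (\<lambda>x::real. indicator {0..} x * exp (- x))"
    by (subst (asm) set_integrable_def, subst (asm) integrable_completion) auto
  have neg: "integrable lborel (\<lambda>x::real. indicator {0..} (- x) * exp x)"
    using lborel_integrable_real_affine[OF pos, of "-1" 0] by simp
  show ?thesis
    by (rule Bochner_Integration.integrable_bound[OF Bochner_Integration.integrable_add[OF pos neg]])
      (auto simp: K'_def indicator_def abs_mult sgn_if)
qed

lemma convolution_exists_bounded:
  assumes [measurable]: "W \<in> borel_measurable borel" and bound: "\<And>\<xi>. \<bar>W \<xi>\<bar> \<le> M"
  shows "convolution_exists K' W x"
proof -
  have "integrable lborel (\<lambda>y. M * K' (x + (- 1) * y))"
    by (intro integrable_mult_right lborel_integrable_real_affine K'_integrable) auto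
  then have "integrable lborel (\<lambda>y. K' (x - y) * W y)"
  proof (rule Bochner_Integration.integrable_bound)
    show "AE y in lborel. norm (K' (x - y) * W y) \<le> norm (M * K' (x + (- 1) * y))"
    proof (intro AE_I2)
      fix y
      have "\<bar>W y\<bar> * \<bar>K' (x - y)\<bar> \<le> \<bar>M\<bar> * \<bar>K' (x - y)\<bar>"
        using bound[of y] by (intro mult_right_mono) auto
      then show "norm (K' (x - y) * W y) \<le> norm (M * K' (x + (- 1) * y))"
        by (simp add: abs_mult mult.commute)
    qed
  qed measurable
  then show "convolution_exists K' W x"
    by (simp add: convolution_exists_def integrable_completion)
qed

lemma convolve_K'_eq:
  assumes [measurable]: "W \<in> borel_measurable borel"
  shows "convolve K' W x = (\<integral>z. K' z * W (x - z) \<partial>lborel)"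
proof -
  have "convolve K' W x = (\<integral>y. K' (x - y) * W y \<partial>lborel)"
    by (simp add: convolve_def integral_completion)
  also have "\<dots> = (\<integral>z. K' z * W (x - z) \<partial>lborel)"
    by (subst lborel_integral_real_affine[of "-1" _ x]) auto
  finally show ?thesis .
qed

lemma convolve_K'_translate:
  assumes [measurable]: "W \<in> borel_measurable borel"
  shows "convolve K' (\<lambda>y. W (y - a)) x = convolve K' W (x - a)"
  by (simp add: convolve_K'_eq algebra_simps)

text \<open>
  After the substitution that moves \<open>x\<close> into the argument of \<open>W\<close>, only the null set \<open>{x}\<close> of
  integration points meets the jump of \<open>W\<close>; dominated convergence does the rest. Thus the nonlocal
  term is continuous even at \<open>0\<close>.
\<close>

lemma convolve_K'_continuous:
  assumes [measurable]: "W \<in> borel_measurable borel" and bound: "\<And>\<xi>. \<bar>W \<xi>\<bar> \<le> M"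
    and cont: "\<And>\<xi>. \<xi> \<noteq> 0 \<Longrightarrow> isCont W \<xi>"
  shows "isCont (convolve K' W) x"
  unfolding continuous_at_sequentially
proof (intro allI impI)
  fix X assume X: "X \<longlonglongrightarrow> x"
  have "(\<lambda>n. \<integral>z. K' z * W (X n - z) \<partial>lborel) \<longlonglongrightarrow> (\<integral>z. K' z * W (x - z) \<partial>lborel)"
  proof (rule integral_dominated_convergence[where w="\<lambda>z. \<bar>K' z\<bar> * M"])
    show "integrable lborel (\<lambda>z. \<bar>K' z\<bar> * M)"
      using K'_integrable by auto
    show "AE z in lborel. (\<lambda>n. K' z * W (X n - z)) \<longlonglongrightarrow> K' z * W (x - z)"
    proof (rule AE_mp[OF AE_lborel_singleton[of x]], intro AE_I2 impI)
      fix z assume "z \<noteq> x"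
      then show "(\<lambda>n. K' z * W (X n - z)) \<longlonglongrightarrow> K' z * W (x - z)"
        by (intro tendsto_mult tendsto_const isCont_tendsto_compose[OF cont] tendsto_diff X) auto
    qed
    show "AE z in lborel. norm (K' z * W (X n - z)) \<le> \<bar>K' z\<bar> * M" for n
      by (auto simp: abs_mult intro!: mult_left_mono bound)
  qed auto
  then show "((convolve K' W) \<circ> X) \<longlonglongrightarrow> convolve K' W x"
    by (simp add: comp_def convolve_K'_eq)
qed

section \<open>Integrals of weights against compactly supported functions\<close>

text \<open>
  The class of continuous functions with compact support, with boundedness of the set of nonzero
  values in place of compactness of its closure. It contains the test functions, their first partial
  derivatives, and all these in moving coordinates and restricted to lines.
\<close>

definition Cc :: "('a::euclidean_space \<Rightarrow> real) \<Rightarrow> bool"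
  where "Cc f \<longleftrightarrow> continuous_on UNIV f \<and> bounded {z. f z \<noteq> 0}"

lemma Cc_continuous: "Cc f \<Longrightarrow> continuous_on S f"
  unfolding Cc_def using continuous_on_subset by blast

lemma Cc_bounded:
  assumes "Cc f" shows "\<exists>M. \<forall>z. \<bar>f z\<bar> \<le> M"
proof -
  have "compact (f ` closure {z. f z \<noteq> 0})"
    using assms by (intro compact_continuous_image Cc_continuous) (simp_all add: Cc_def compact_closure)
  then have "bounded (f ` closure {z. f z \<noteq> 0})"
    by (rule compact_imp_bounded)
  then obtain M where M: "\<And>z. z \<in> closure {z. f z \<noteq> 0} \<Longrightarrow> \<bar>f z\<bar> \<le> M"
    unfolding bounded_iff by force
  have "\<bar>f z\<bar> \<le> \<bar>M\<bar>" for z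
    using M[of z] closure_subset[of "{z. f z \<noteq> 0}"] by (cases "f z = 0") fastforce+
  then show ?thesis
    by blast
qed

text \<open>
  The map \<open>h\<close> is a left inverse of the substitution \<open>g\<close>: it carries the support of \<open>f\<close> onto a set
  that covers the support of the composition.
\<close>

lemma Cc_compose:
  assumes "Cc f" and "continuous_on UNIV g" and "bounded (h ` {z. f z \<noteq> 0})"
    and "\<And>x. h (g x) = x"
  shows "Cc (\<lambda>x. f (g x))"
  unfolding Cc_def
proof
  show "continuous_on UNIV (\<lambda>x. f (g x))"
    using continuous_on_compose2[OF Cc_continuous[OF assms(1), of UNIV] assms(2)] by simp
  have "{x. f (g x) \<noteq> 0} \<subseteq> h ` {z. f z \<noteq> 0}"
    using assms(4) by (metis (mono_tags, lifting) image_eqI mem_Collect_eq subsetI)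
  then show "bounded {x. f (g x) \<noteq> 0}"
    using assms(3) bounded_subset by blast
qed

lemma Cc_section_fst: "Cc f \<Longrightarrow> Cc (\<lambda>x. f (x, t))"
  by (rule Cc_compose[where h=fst]) (simp_all add: continuous_intros bounded_fst Cc_def)

lemma Cc_section_snd: "Cc f \<Longrightarrow> Cc (\<lambda>t. f (x, t))"
  by (rule Cc_compose[where h=snd]) (simp_all add: continuous_intros bounded_snd Cc_def)

lemma Cc_shear:
  fixes f :: "real \<times> real \<Rightarrow> real"
  assumes "Cc f" shows "Cc (\<lambda>z. f (fst z + c * snd z, snd z))"
proof (rule Cc_compose[OF assms, where h="\<lambda>z. (fst z - c * snd z, snd z)"])
  have "linear (\<lambda>z::real \<times> real. (fst z - c * snd z, snd z))"
    by (rule linearI) (simp_all add: algebra_simps)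
  then show "bounded ((\<lambda>z. (fst z - c * snd z, snd z)) ` {z. f z \<noteq> 0})"
    using assms unfolding Cc_def by (intro bounded_linear_image) (simp_all add: linear_linear)
qed (simp_all add: continuous_intros)

lemma Cc_add:
  assumes "Cc f" "Cc g" shows "Cc (\<lambda>x. f x + g x)"
proof -
  have "bounded ({x. f x \<noteq> 0} \<union> {x. g x \<noteq> 0})"
    using assms by (simp add: Cc_def)
  then have "bounded {x. f x + g x \<noteq> 0}"
    by (rule bounded_subset) auto
  then show ?thesis
    using assms by (simp add: Cc_def continuous_on_add)
qed

lemma Cc_cmult:
  assumes "Cc f" shows "Cc (\<lambda>x. k * f x)"
proof -
  have "bounded {x. k * f x \<noteq> 0}"
    by (rule bounded_subset[of "{x. f x \<noteq> 0}"]) (use assms in \<open>auto simp: Cc_def\<close>)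
  then show ?thesis
    using assms by (simp add: Cc_def continuous_on_mult_left)
qed

lemma Cc_vanishes_outside:
  fixes f :: "real \<Rightarrow> real"
  assumes "Cc f"
  obtains R where "\<And>x. R < \<bar>x\<bar> \<Longrightarrow> f x = 0"
proof -
  obtain R where "\<forall>x\<in>{x. f x \<noteq> 0}. norm x \<le> R"
    using assms unfolding Cc_def bounded_iff by blast
  then have "f x = 0" if "R < \<bar>x\<bar>" for x
    using that by force
  then show thesis
    using that by blast
qed

lemma Cc_tendsto_0:
  fixes f :: "real \<Rightarrow> real"
  assumes "Cc f"
  shows "((\<lambda>x. a x * f x) \<longlongrightarrow> 0) at_top" "((\<lambda>x. a x * f x) \<longlongrightarrow> 0) at_bot"
proof -
  obtain R where R: "\<And>x. R < \<bar>x\<bar> \<Longrightarrow> f x = 0"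
    using assms Cc_vanishes_outside by blast
  show "((\<lambda>x. a x * f x) \<longlongrightarrow> 0) at_top"
    by (intro tendsto_eventually eventually_at_top_linorderI[of "\<bar>R\<bar> + 1"]) (simp add: R)
  show "((\<lambda>x. a x * f x) \<longlongrightarrow> 0) at_bot"
    unfolding filterlim_at_bot_mirror
    by (intro tendsto_eventually eventually_at_top_linorderI[of "\<bar>R\<bar> + 1"]) (simp add: R)
qed

text \<open>
  The coefficients of the weak formulation (\<open>W\<close>, its flux, its derivative, the nonlocal term) are
  discontinuous. Borel measurability with bounds on bounded intervals is all that is
  required to integrate them against functions in \<open>Cc\<close>, and it is stable under sums and products.
\<close>

definition locally_bounded :: "(real \<Rightarrow> real) \<Rightarrow> bool"
  where "locally_bounded a \<longleftrightarrow>
    a \<in> borel_measurable borel \<and> (\<forall>R. \<exists>M. \<forall>x\<in>{-R..R}. \<bar>a x\<bar> \<le> M)"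

lemma locally_bounded_const: "locally_bounded (\<lambda>_. k)"
  by (auto simp: locally_bounded_def)

lemma locally_bounded_add:
  assumes "locally_bounded a" "locally_bounded b"
  shows "locally_bounded (\<lambda>x. a x + b x)"
  unfolding locally_bounded_def
proof (intro conjI allI)
  fix R
  obtain M N where "\<forall>x\<in>{-R..R}. \<bar>a x\<bar> \<le> M" "\<forall>x\<in>{-R..R}. \<bar>b x\<bar> \<le> N"
    using assms unfolding locally_bounded_def by meson
  then have "\<forall>x\<in>{-R..R}. \<bar>a x + b x\<bar> \<le> M + N"
    by (auto intro!: order_trans[OF abs_triangle_ineq] add_mono)
  then show "\<exists>M. \<forall>x\<in>{-R..R}. \<bar>a x + b x\<bar> \<le> M" ..
qed (use assms in \<open>auto simp: locally_bounded_def\<close>)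

lemma locally_bounded_mult:
  assumes "locally_bounded a" "locally_bounded b"
  shows "locally_bounded (\<lambda>x. a x * b x)"
  unfolding locally_bounded_def
proof (intro conjI allI)
  fix R
  obtain M N where "\<forall>x\<in>{-R..R}. \<bar>a x\<bar> \<le> M" "\<forall>x\<in>{-R..R}. \<bar>b x\<bar> \<le> N"
    using assms unfolding locally_bounded_def by meson
  then have "\<forall>x\<in>{-R..R}. \<bar>a x * b x\<bar> \<le> \<bar>M\<bar> * \<bar>N\<bar>"
    by (auto simp: abs_mult intro!: mult_mono intro: order_trans[OF _ abs_ge_self])
  then show "\<exists>M. \<forall>x\<in>{-R..R}. \<bar>a x * b x\<bar> \<le> M" ..
qed (use assms in \<open>auto simp: locally_bounded_def\<close>)

lemma locally_bounded_continuous: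
  assumes "continuous_on UNIV a"
  shows "locally_bounded a"
proof -
  have "bounded (a ` {-R..R})" for R
    using assms by (intro compact_imp_bounded compact_continuous_image)
      (auto intro: continuous_on_subset)
  with assms show ?thesis
    by (auto simp: locally_bounded_def bounded_iff intro: borel_measurable_continuous_onI)
qed

lemma integrable_weight_plane:
  fixes f :: "real \<times> real \<Rightarrow> real"
  assumes a: "locally_bounded a" and f: "Cc f"
  shows "integrable lborel (\<lambda>(x, t). a (x - c * t) * f (x, t))"
proof -
  obtain N where N: "\<And>z. \<bar>f z\<bar> \<le> N"
    using Cc_bounded[OF f] by blast
  obtain R where R: "\<And>z. f z \<noteq> 0 \<Longrightarrow> norm z \<le> R"
    using f by (auto simp: Cc_def bounded_iff)
  define R' where "R' = R + \<bar>c\<bar> * R"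
  obtain M where M: "\<And>x. x \<in> {-R'..R'} \<Longrightarrow> \<bar>a x\<bar> \<le> M"
    using a unfolding locally_bounded_def by meson
  have [measurable]: "a \<in> borel_measurable borel" "f \<in> borel_measurable borel"
    using a f by (auto simp: locally_bounded_def Cc_def intro: borel_measurable_continuous_onI)
  have [measurable]: "(\<lambda>z::real \<times> real. fst z - c * snd z) \<in> borel_measurable borel"
    by (intro borel_measurable_continuous_onI continuous_intros)
  show ?thesis
  proof (rule integrable_bounded_support[where S="{z. f z \<noteq> 0}" and M="\<bar>M\<bar> * N"])
    fix z assume "z \<in> {z. f z \<noteq> 0}"
    then have "\<bar>fst z\<bar> \<le> R" "\<bar>snd z\<bar> \<le> R"
      using R[of z] norm_fst_le[of "fst z" "snd z"] norm_snd_le[of "snd z" "fst z"] by auto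
    moreover from this have "\<bar>c * snd z\<bar> \<le> \<bar>c\<bar> * R"
      by (auto simp: abs_mult intro: mult_left_mono)
    ultimately have "\<bar>a (fst z - c * snd z)\<bar> \<le> \<bar>M\<bar>"
      by (intro order_trans[OF M abs_ge_self]) (auto simp: R'_def)
    then show "\<bar>case z of (x, t) \<Rightarrow> a (x - c * t) * f (x, t)\<bar> \<le> \<bar>M\<bar> * N"
      using N[of z] by (auto simp: case_prod_beta abs_mult intro!: mult_mono)
  next
    have "(\<lambda>z. a (fst z - c * snd z) * f z) \<in> borel_measurable borel"
      by measurable
    then show "(\<lambda>(x, t). a (x - c * t) * f (x, t)) \<in> borel_measurable borel"
      by (simp add: case_prod_beta')
    show "bounded {z. f z \<noteq> 0}"
      using f by (simp add: Cc_def)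
  qed (simp add: case_prod_beta')
qed

lemma integrable_weight_line:
  assumes a: "locally_bounded a" and f: "Cc f"
  shows "integrable lborel (\<lambda>x. a x * f x)"
proof -
  obtain N where N: "\<And>z. \<bar>f z\<bar> \<le> N"
    using Cc_bounded[OF f] by blast
  obtain R where R: "\<And>z. f z \<noteq> 0 \<Longrightarrow> norm z \<le> R"
    using f by (auto simp: Cc_def bounded_iff)
  obtain M where M: "\<And>x. x \<in> {-R..R} \<Longrightarrow> \<bar>a x\<bar> \<le> M"
    using a unfolding locally_bounded_def by meson
  have [measurable]: "a \<in> borel_measurable borel" "f \<in> borel_measurable borel"
    using a f by (auto simp: locally_bounded_def Cc_def intro: borel_measurable_continuous_onI)
  show ?thesis
  proof (rule integrable_bounded_support[where S="{z. f z \<noteq> 0}" and M="\<bar>M\<bar> * N"])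
    fix z assume "z \<in> {z. f z \<noteq> 0}"
    then have "\<bar>a z\<bar> \<le> \<bar>M\<bar>"
      using R[of z] by (intro order_trans[OF M abs_ge_self]) auto
    then show "\<bar>a z * f z\<bar> \<le> \<bar>M\<bar> * N"
      using N[of z] by (auto simp: abs_mult intro!: mult_mono)
  qed (use f in \<open>auto simp: Cc_def\<close>)
qed

text \<open>
  The integral of \<open>(F f)'\<close> over \<open>\<xi> > 0\<close> is \<open>- r f(0)\<close> and over \<open>\<xi> < 0\<close> it is \<open>l f(0)\<close>, since
  \<open>f\<close> vanishes near infinity. The jump of \<open>F\<close> is therefore the only obstruction to the usual
  formula; this is where the Rankine-Hugoniot condition originates.
\<close>

lemma integral_half_lines_by_parts:
  assumes F: "\<And>\<xi>. \<xi> \<noteq> 0 \<Longrightarrow> (F has_field_derivative F' \<xi>) (at \<xi>)"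
    and F'_cont: "\<And>\<xi>. \<xi> \<noteq> 0 \<Longrightarrow> isCont F' \<xi>"
    and l: "(F \<longlongrightarrow> l) (at_left 0)" and r: "(F \<longlongrightarrow> r) (at_right 0)"
    and lb: "locally_bounded F" "locally_bounded F'"
    and f: "\<And>\<xi>. (f has_field_derivative f' \<xi>) (at \<xi>)" and Cc: "Cc f" "Cc f'"
  shows "(\<integral>\<xi>. F \<xi> * f' \<xi> \<partial>lborel) + (\<integral>\<xi>. F' \<xi> * f \<xi> \<partial>lborel) = (l - r) * f 0"
proof -
  let ?D = "\<lambda>\<xi>. F \<xi> * f' \<xi> + F' \<xi> * f \<xi>"
  have int: "integrable lborel (\<lambda>\<xi>. F \<xi> * f' \<xi>)" "integrable lborel (\<lambda>\<xi>. F' \<xi> * f \<xi>)"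
    using lb Cc by (auto intro: integrable_weight_line)
  then have intD: "integrable lborel ?D"
    by auto
  have set_intD: "set_integrable lborel A ?D" if "A \<in> sets borel" for A
    using integrable_mult_indicator[OF _ intD, of A] that by (auto simp: set_integrable_def)
  have deriv: "((\<lambda>\<xi>. F \<xi> * f \<xi>) has_vector_derivative ?D \<xi>) (at \<xi>)" if "\<xi> \<noteq> 0" for \<xi>
    using DERIV_mult[OF F[OF that] f]
    by (simp add: has_real_derivative_iff_has_vector_derivative[symmetric] algebra_simps)
  have cont: "isCont ?D \<xi>" if "\<xi> \<noteq> 0" for \<xi>
    using F'_cont[OF that] DERIV_isCont[OF F[OF that]] Cc
    by (auto intro!: continuous_intros simp: Cc_def continuous_on_eq_continuous_at)
  have f0: "(f \<longlongrightarrow> f 0) (at 0 within S)" for S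
    using Cc(1) by (auto simp: Cc_def continuous_on_def intro: tendsto_within_subset)
  have "(LBINT \<xi>=0..\<infinity>. ?D \<xi>) = 0 - r * f 0"
  proof (rule interval_integral_FTC_integrable)
    show "(((\<lambda>\<xi>. F \<xi> * f \<xi>) \<circ> real_of_ereal) \<longlongrightarrow> r * f 0) (at_right 0)"
      unfolding zero_ereal_def ereal_tendsto_simps by (intro tendsto_mult r f0)
    show "(((\<lambda>\<xi>. F \<xi> * f \<xi>) \<circ> real_of_ereal) \<longlongrightarrow> 0) (at_left \<infinity>)"
      unfolding ereal_tendsto_simps using Cc by (intro Cc_tendsto_0)
  qed (use deriv cont set_intD in \<open>auto simp: zero_ereal_def\<close>)
  moreover have "(LBINT \<xi>=-\<infinity>..0. ?D \<xi>) = l * f 0 - 0"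
  proof (rule interval_integral_FTC_integrable)
    show "(((\<lambda>\<xi>. F \<xi> * f \<xi>) \<circ> real_of_ereal) \<longlongrightarrow> l * f 0) (at_left 0)"
      unfolding zero_ereal_def ereal_tendsto_simps by (intro tendsto_mult l f0)
    show "(((\<lambda>\<xi>. F \<xi> * f \<xi>) \<circ> real_of_ereal) \<longlongrightarrow> 0) (at_right (-\<infinity>))"
      unfolding ereal_tendsto_simps using Cc by (intro Cc_tendsto_0)
  qed (use deriv cont set_intD in \<open>auto simp: zero_ereal_def\<close>)
  moreover have "(\<integral>\<xi>. ?D \<xi> \<partial>lborel) = (LBINT \<xi>=-\<infinity>..0. ?D \<xi>) + (LBINT \<xi>=0..\<infinity>. ?D \<xi>)"
  proof -
    have "(\<integral>\<xi>. ?D \<xi> \<partial>lborel)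
        = (\<integral>\<xi>. indicator {..<0} \<xi> *\<^sub>R ?D \<xi> + indicator {0<..} \<xi> *\<^sub>R ?D \<xi> \<partial>lborel)"
      using intD set_intD[unfolded set_integrable_def]
      by (intro integral_cong_AE AE_mp[OF AE_lborel_singleton[of 0] AE_I2])
        (auto simp: indicator_def intro!: borel_measurable_integrable)
    also have "\<dots> = (LBINT \<xi>:{..<0}. ?D \<xi>) + (LBINT \<xi>:{0<..}. ?D \<xi>)"
      unfolding set_lebesgue_integral_def
      using set_intD[unfolded set_integrable_def] by (intro Bochner_Integration.integral_add) auto
    finally show ?thesis
      by (simp add: interval_lebesgue_integral_def zero_ereal_def)
  qed
  ultimately show ?thesis
    using int by (simp add: algebra_simps)
qed

lemma integrable_time_slices:
  fixes f :: "real \<times> real \<Rightarrow> real"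
  assumes "locally_bounded a" "Cc f"
  shows "integrable lborel (\<lambda>t. \<integral>\<xi>. a \<xi> * f (\<xi>, t) \<partial>lborel)"
  using lborel_pair.integrable_snd[of "\<lambda>\<xi> t. a \<xi> * f (\<xi>, t)"] integrable_weight_plane[OF assms, of 0]
  by (simp add: lborel_prod)

text \<open>
  The order of integration is exchanged, and for fixed \<open>\<xi>\<close> the inner integral over \<open>t \<ge> 0\<close> is
  evaluated by the fundamental theorem; the compact support removes the contribution at infinity.
\<close>

lemma time_integral_initial_value:
  assumes a: "locally_bounded a" and Cc: "Cc \<psi>" "Cc \<psi>t"
    and \<psi>: "\<And>\<xi> t. ((\<lambda>s. \<psi> (\<xi>, s)) has_field_derivative \<psi>t (\<xi>, t)) (at t)"
  shows "(LBINT t:{0..}. \<integral>\<xi>. a \<xi> * \<psi>t (\<xi>, t) \<partial>lborel) = - (\<integral>\<xi>. a \<xi> * \<psi> (\<xi>, 0) \<partial>lborel)"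
proof -
  have plane: "integrable (lborel \<Otimes>\<^sub>M lborel) (\<lambda>(\<xi>, t). a \<xi> * \<psi>t (\<xi>, t))"
    using integrable_weight_plane[OF a Cc(2), of 0] by (simp add: lborel_prod)
  have "(LBINT t:{0..}. \<integral>\<xi>. a \<xi> * \<psi>t (\<xi>, t) \<partial>lborel)
      = (\<integral>t. \<integral>\<xi>. indicator {0..} t * (a \<xi> * \<psi>t (\<xi>, t)) \<partial>lborel \<partial>lborel)"
    by (simp add: set_lebesgue_integral_def)
  also have "\<dots> = (\<integral>\<xi>. \<integral>t. indicator {0..} t * (a \<xi> * \<psi>t (\<xi>, t)) \<partial>lborel \<partial>lborel)"
  proof (rule lborel_pair.Fubini_integral)
    have "integrable (lborel \<Otimes>\<^sub>M lborel)
        (\<lambda>z. indicator (UNIV \<times> {0..}) z *\<^sub>R (case z of (\<xi>, t) \<Rightarrow> a \<xi> * \<psi>t (\<xi>, t)))"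
      by (rule integrable_mult_indicator[OF _ plane]) auto
    then show "integrable (lborel \<Otimes>\<^sub>M lborel)
        (\<lambda>(\<xi>, t). indicator {0..} t * (a \<xi> * \<psi>t (\<xi>, t)))"
      by (simp add: case_prod_beta' indicator_def mem_Times_iff)
  qed
  also have "\<dots> = (\<integral>\<xi>. a \<xi> * - \<psi> (\<xi>, 0) \<partial>lborel)"
  proof (rule Bochner_Integration.integral_cong[OF refl])
    fix \<xi>
    have Cc\<xi>: "Cc (\<lambda>t. \<psi> (\<xi>, t))" "Cc (\<lambda>t. \<psi>t (\<xi>, t))"
      using Cc Cc_section_snd by blast+
    have int: "integrable lborel (\<lambda>t. \<psi>t (\<xi>, t))"
      using integrable_weight_line[OF locally_bounded_const Cc\<xi>(2), of 1] by simp
    have "(LBINT t=0..\<infinity>. \<psi>t (\<xi>, t)) = 0 - \<psi> (\<xi>, 0)"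
    proof (rule interval_integral_FTC_integrable[where F="\<lambda>t. \<psi> (\<xi>, t)"])
      show "(((\<lambda>t. \<psi> (\<xi>, t)) \<circ> real_of_ereal) \<longlongrightarrow> \<psi> (\<xi>, 0)) (at_right 0)"
        unfolding zero_ereal_def ereal_tendsto_simps
        using Cc\<xi>(1) by (auto simp: Cc_def continuous_on_def intro: tendsto_within_subset)
      show "(((\<lambda>t. \<psi> (\<xi>, t)) \<circ> real_of_ereal) \<longlongrightarrow> 0) (at_left \<infinity>)"
        unfolding ereal_tendsto_simps using Cc_tendsto_0(1)[OF Cc\<xi>(1), of "\<lambda>_. 1"] by simp
      show "set_integrable lborel (einterval 0 \<infinity>) (\<lambda>t. \<psi>t (\<xi>, t))"
        using integrable_mult_indicator[OF _ int] by (auto simp: set_integrable_def zero_ereal_def)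
      show "isCont (\<lambda>t. \<psi>t (\<xi>, t)) t" for t
        using Cc\<xi>(2) by (auto simp: Cc_def continuous_on_eq_continuous_at)
    qed (use \<psi> in \<open>auto simp: has_real_derivative_iff_has_vector_derivative[symmetric]\<close>)
    moreover have "(LBINT t=0..\<infinity>. \<psi>t (\<xi>, t)) = (\<integral>t. indicator {0..} t * \<psi>t (\<xi>, t) \<partial>lborel)"
      using borel_measurable_integrable[OF int]
      by (auto simp: interval_lebesgue_integral_def zero_ereal_def set_lebesgue_integral_def indicator_def
          intro!: integral_cong_AE AE_mp[OF AE_lborel_singleton[of 0] AE_I2])
    ultimately show "(\<integral>t. indicator {0..} t * (a \<xi> * \<psi>t (\<xi>, t)) \<partial>lborel) = a \<xi> * - \<psi> (\<xi>, 0)"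
      by (simp add: mult.left_commute[of _ "a \<xi>"])
  qed
  finally show "(LBINT t:{0..}. \<integral>\<xi>. a \<xi> * \<psi>t (\<xi>, t) \<partial>lborel) = - (\<integral>\<xi>. a \<xi> * \<psi> (\<xi>, 0) \<partial>lborel)"
    by simp
qed

section \<open>The weak formulation in the frame of the wave\<close>

text \<open>
  Off the closed support of \<open>\<phi>\<close>, the function vanishes on a neighbourhood, and so do its derivatives.
\<close>

lemma
  assumes "test_function \<phi>"
  shows test_function_has_derivative: "(\<phi> has_derivative
      (\<lambda>(h, k). partial_x \<phi> (x, t) * h + partial_t \<phi> (x, t) * k)) (at (x, t))"
    and test_function_Cc: "Cc \<phi>" "Cc (partial_x \<phi>)" "Cc (partial_t \<phi>)"
proof -
  have "Ck_fun (Suc 0) \<phi>"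
    using assms unfolding test_function_def by blast
  then have C1: "(\<forall>p. \<phi> differentiable (at p)) \<and>
      continuous_on UNIV (partial_x \<phi>) \<and> continuous_on UNIV (partial_t \<phi>)"
    unfolding Ck_fun.simps .
  have diff: "\<phi> differentiable (at p)" for p
    using conjunct1[OF C1] by (rule spec)
  have cont: "continuous_on UNIV (partial_x \<phi>)" "continuous_on UNIV (partial_t \<phi>)"
    using conjunct2[OF C1] by simp_all
  show deriv: "(\<phi> has_derivative (\<lambda>(h, k). partial_x \<phi> (x, t) * h + partial_t \<phi> (x, t) * k)) (at (x, t))"
    for x t
  proof -
    obtain D where D: "(\<phi> has_derivative D) (at (x, t))"
      using diff unfolding differentiable_def by blast
    have "D (h, k) = partial_x \<phi> (x, t) * h + partial_t \<phi> (x, t) * k" for h k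
    proof -
      have "D (h, k) = D (h *\<^sub>R (1, 0) + k *\<^sub>R (0, 1))"
        by simp
      also have "\<dots> = h *\<^sub>R D (1, 0) + k *\<^sub>R D (0, 1)"
        using has_derivative_linear[OF D] by (simp only: linear_add linear_scale)
      finally show ?thesis
        by (simp add: partials_of_has_derivative[OF D] mult.commute)
    qed
    then have "D = (\<lambda>(h, k). partial_x \<phi> (x, t) * h + partial_t \<phi> (x, t) * k)"
      by auto
    with D show ?thesis
      by simp
  qed
  have "bounded {p. \<phi> p \<noteq> 0}" and bd: "bounded (closure {p. \<phi> p \<noteq> 0})"
    using assms unfolding test_function_def by (simp_all add: compact_closure bounded_closure)
  moreover have "continuous_on UNIV \<phi>"
    using diff by (intro continuous_at_imp_continuous_on ballI differentiable_imp_continuous_within)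
  ultimately show "Cc \<phi>"
    by (simp add: Cc_def)
  have off: "partial_x \<phi> p = 0 \<and> partial_t \<phi> p = 0" if p: "p \<notin> closure {p. \<phi> p \<noteq> 0}" for p
  proof -
    obtain x t where xt: "p = (x, t)"
      by fastforce
    have "(\<phi> has_derivative (\<lambda>_. 0)) (at (x, t))"
    proof (rule has_derivative_transform_within_open)
      show "((\<lambda>_. 0) has_derivative (\<lambda>_. 0)) (at (x, t))"
        by simp
      show "open (- closure {p. \<phi> p \<noteq> 0})"
        by (simp add: open_Compl)
      show "(x, t) \<in> - closure {p. \<phi> p \<noteq> 0}"
        using p xt by simp
      show "0 = \<phi> q" if "q \<in> - closure {p. \<phi> p \<noteq> 0}" for q
        using that closure_subset[of "{p. \<phi> p \<noteq> 0}"] by fastforce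
    qed
    from has_derivative_unique[OF deriv this]
    have eq: "(case v of (h, k) \<Rightarrow> partial_x \<phi> (x, t) * h + partial_t \<phi> (x, t) * k) = 0" for v
      by (rule fun_cong)
    show ?thesis
      using eq[of "(1, 0)"] eq[of "(0, 1)"] xt by simp
  qed
  have "bounded {p. partial_x \<phi> p \<noteq> 0}" "bounded {p. partial_t \<phi> p \<noteq> 0}"
    by (rule bounded_subset[OF bd]; use off in blast)+
  with cont show "Cc (partial_x \<phi>)" "Cc (partial_t \<phi>)"
    by (simp_all add: Cc_def)
qed

lemma
  assumes "profile_function W"
  shows profile_locally_bounded: "locally_bounded W"
    and profile_deriv_locally_bounded: "locally_bounded (deriv W)"
    and profile_convolve_isCont: "isCont (convolve K' W) x"
    and profile_convolve_locally_bounded: "locally_bounded (convolve K' W)"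
proof -
  obtain M where M: "\<And>\<xi>. \<bar>W \<xi>\<bar> \<le> M"
    using profile_bounded[OF assms] by blast
  then show "locally_bounded W"
    using profile_measurable(1)[OF assms] unfolding locally_bounded_def by blast
  show "locally_bounded (deriv W)"
  proof -
    obtain l r where "(deriv W \<longlongrightarrow> l) (at_left 0)" "(deriv W \<longlongrightarrow> r) (at_right 0)"
      using assms by (auto simp: profile_function_def)
    then show ?thesis
      using profile_measurable(2)[OF assms]
        bounded_near_one_sided_limits[OF profile_deriv_continuous_on[OF assms]]
      unfolding locally_bounded_def by blast
  qed
  show isCont: "isCont (convolve K' W) x" for x
    using convolve_K'_continuous[OF profile_measurable(1)[OF assms] M profile_isCont[OF assms]] .
  show "locally_bounded (convolve K' W)"
    by (intro locally_bounded_continuous continuous_at_imp_continuous_on ballI isCont)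
qed

definition residual :: "real \<Rightarrow> (real \<Rightarrow> real) \<Rightarrow> real \<Rightarrow> real"
  where "residual c W \<xi> = (W \<xi> - c) * deriv W \<xi> + convolve K' W \<xi>"

lemma residual_isCont:
  assumes "profile_function W" "\<xi> \<noteq> 0"
  shows "isCont (residual c W) \<xi>"
  unfolding residual_def
  using assms by (intro continuous_intros profile_isCont profile_deriv_isCont profile_convolve_isCont)

lemma residual_locally_bounded:
  assumes "profile_function W"
  shows "locally_bounded (residual c W)"
  using locally_bounded_add[OF locally_bounded_mult[OF locally_bounded_add[OF
      profile_locally_bounded[OF assms] locally_bounded_const[of "- c"]] profile_deriv_locally_bounded[OF assms]]
      profile_convolve_locally_bounded[OF assms]]
  by (simp add: residual_def[abs_def])

text \<open>
  The jump at \<open>0\<close> of the flux \<open>c W - W\<^sup>2 / 2\<close> in the moving frame, left limit minus right limit, in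
  factored form. One factor is the jump of \<open>W\<close>, the other is the Rankine-Hugoniot condition.
\<close>

definition shock_defect :: "real \<Rightarrow> (real \<Rightarrow> real) \<Rightarrow> real"
  where "shock_defect c W = (lim_left0 W - lim_right0 W) * (c - (lim_left0 W + lim_right0 W) / 2)"

text \<open>
  Translation invariance of the convolution gives all three coefficients the form \<open>a (x - c t)\<close>.
\<close>

lemma weak_integrand_travelling:
  assumes "profile_function W"
  shows "weak_integrand (\<lambda>x t. W (x - c * t)) \<phi> x t =
    (- 1 * W (x - c * t)) * partial_t \<phi> (x, t) + (- (1 / 2) * (W (x - c * t) * W (x - c * t))) * partial_x \<phi> (x, t)
    + convolve K' W (x - c * t) * \<phi> (x, t)"
  unfolding weak_integrand_def convolve_K'_translate[OF profile_measurable(1)[OF assms]]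
  by (simp add: power2_eq_square)

lemma integrable_weak_integrand:
  assumes W: "profile_function W" and \<phi>: "test_function \<phi>"
  shows "integrable lborel (\<lambda>(x, t). weak_integrand (\<lambda>x t. W (x - c * t)) \<phi> x t)"
proof -
  note lb = locally_bounded_mult locally_bounded_const profile_locally_bounded[OF W]
    profile_convolve_locally_bounded[OF W]
  have 1: "integrable lborel (\<lambda>(x, t). (- 1 * W (x - c * t)) * partial_t \<phi> (x, t))"
    by (intro integrable_weight_plane lb test_function_Cc[OF \<phi>])
  have 2: "integrable lborel
      (\<lambda>(x, t). (- (1 / 2) * (W (x - c * t) * W (x - c * t))) * partial_x \<phi> (x, t))"
    by (intro integrable_weight_plane[where a="\<lambda>\<xi>. - (1 / 2) * (W \<xi> * W \<xi>)"] lb test_function_Cc[OF \<phi>])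
  have 3: "integrable lborel (\<lambda>(x, t). convolve K' W (x - c * t) * \<phi> (x, t))"
    by (intro integrable_weight_plane lb test_function_Cc[OF \<phi>])
  show ?thesis
    using Bochner_Integration.integrable_add[OF Bochner_Integration.integrable_add[OF 1 2] 3]
    by (simp add: weak_integrand_travelling[OF W] case_prod_beta')
qed

text \<open>
  At a fixed time, in the variable \<open>\<xi> = x - c t\<close>: the function \<open>\<psi>t\<close> is the time derivative of the
  test function along the lines \<open>\<xi> = const\<close>. Writing \<open>\<partial>\<^sub>t \<phi> = \<psi>t - c \<partial>\<^sub>x \<phi>\<close> moves \<open>c W\<close> into the
  flux, which is then integrated by parts across the jump.
\<close>

lemma weak_integrand_slice:
  fixes c :: real
  assumes W: "profile_function W" and \<phi>: "test_function \<phi>"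
  defines "\<psi>t \<equiv> \<lambda>z. partial_t \<phi> (fst z + c * snd z, snd z) + c * partial_x \<phi> (fst z + c * snd z, snd z)"
  shows "(\<integral>x. weak_integrand (\<lambda>x t. W (x - c * t)) \<phi> x t \<partial>lborel) =
    - (\<integral>\<xi>. W \<xi> * \<psi>t (\<xi>, t) \<partial>lborel)
    + (shock_defect c W * \<phi> (c * t, t) + (\<integral>\<xi>. residual c W \<xi> * \<phi> (\<xi> + c * t, t) \<partial>lborel))"
proof -
  define f where "f \<xi> = \<phi> (\<xi> + c * t, t)" for \<xi>
  define fx where "fx \<xi> = partial_x \<phi> (\<xi> + c * t, t)" for \<xi>
  define ft where "ft \<xi> = partial_t \<phi> (\<xi> + c * t, t)" for \<xi>
  have Cc: "Cc f" "Cc fx" "Cc ft"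
    using Cc_section_fst[OF Cc_shear[OF test_function_Cc(1)[OF \<phi>]], of t c]
      Cc_section_fst[OF Cc_shear[OF test_function_Cc(2)[OF \<phi>]], of t c]
      Cc_section_fst[OF Cc_shear[OF test_function_Cc(3)[OF \<phi>]], of t c]
    by (simp_all add: f_def[abs_def] fx_def[abs_def] ft_def[abs_def])
  define F where "F \<xi> = c * W \<xi> + - (1 / 2) * (W \<xi> * W \<xi>)" for \<xi>
  define F' where "F' \<xi> = (c + - 1 * W \<xi>) * deriv W \<xi>" for \<xi>
  note lbW = profile_locally_bounded[OF W] profile_deriv_locally_bounded[OF W] profile_convolve_locally_bounded[OF W]
  have lb: "locally_bounded F" "locally_bounded F'"
    unfolding F_def[abs_def] F'_def[abs_def]
    by (intro locally_bounded_add locally_bounded_mult locally_bounded_const lbW)+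
  have int: "integrable lborel (\<lambda>\<xi>. W \<xi> * (ft \<xi> + c * fx \<xi>))" "integrable lborel (\<lambda>\<xi>. F \<xi> * fx \<xi>)"
    "integrable lborel (\<lambda>\<xi>. F' \<xi> * f \<xi>)" "integrable lborel (\<lambda>\<xi>. convolve K' W \<xi> * f \<xi>)"
  proof -
    have "integrable lborel (\<lambda>\<xi>. W \<xi> * ft \<xi> + c * (W \<xi> * fx \<xi>))"
      by (intro Bochner_Integration.integrable_add integrable_mult_right integrable_weight_line lbW Cc)
    then show "integrable lborel (\<lambda>\<xi>. W \<xi> * (ft \<xi> + c * fx \<xi>))"
      by (simp add: algebra_simps)
  qed (intro integrable_weight_line lb lbW Cc)+
  have parts: "(\<integral>\<xi>. F \<xi> * fx \<xi> \<partial>lborel) + (\<integral>\<xi>. F' \<xi> * f \<xi> \<partial>lborel)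
      = ((c * lim_left0 W + - (1 / 2) * (lim_left0 W * lim_left0 W))
        - (c * lim_right0 W + - (1 / 2) * (lim_right0 W * lim_right0 W))) * f 0"
  proof (rule integral_half_lines_by_parts)
    fix \<xi> :: real assume "\<xi> \<noteq> 0"
    show "(F has_field_derivative F' \<xi>) (at \<xi>)"
      unfolding F_def[abs_def] F'_def
      by (auto intro!: derivative_eq_intros profile_DERIV[OF W] \<open>\<xi> \<noteq> 0\<close> simp: algebra_simps)
    show "isCont F' \<xi>"
      unfolding F'_def[abs_def]
      by (intro continuous_intros profile_isCont[OF W] profile_deriv_isCont[OF W] \<open>\<xi> \<noteq> 0\<close>)
  next
    show "(F \<longlongrightarrow> c * lim_left0 W + - (1 / 2) * (lim_left0 W * lim_left0 W)) (at_left 0)"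
      unfolding F_def[abs_def] by (intro tendsto_intros profile_tendsto_left[OF W])
    show "(F \<longlongrightarrow> c * lim_right0 W + - (1 / 2) * (lim_right0 W * lim_right0 W)) (at_right 0)"
      unfolding F_def[abs_def] by (intro tendsto_intros profile_tendsto_right[OF W])
    fix \<xi>
    have "((\<lambda>\<xi>. (\<xi> + c * t, t)) has_derivative (\<lambda>h. (h, 0))) (at \<xi>)"
      by (auto intro!: derivative_eq_intros)
    from has_derivative_compose[OF this test_function_has_derivative[OF \<phi>]]
    show "(f has_field_derivative fx \<xi>) (at \<xi>)"
      unfolding has_field_derivative_def f_def[abs_def] fx_def by (rule has_derivative_eq_rhs) auto
  qed (fact lb Cc)+
  have "(\<integral>x. weak_integrand (\<lambda>x t. W (x - c * t)) \<phi> x t \<partial>lborel)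
      = (\<integral>\<xi>. weak_integrand (\<lambda>x t. W (x - c * t)) \<phi> (\<xi> + c * t) t \<partial>lborel)"
    by (subst lborel_integral_real_affine[of 1 _ "c * t"]) (simp_all add: add.commute)
  also have "\<dots> = (\<integral>\<xi>. - (W \<xi> * (ft \<xi> + c * fx \<xi>)) + F \<xi> * fx \<xi> + convolve K' W \<xi> * f \<xi> \<partial>lborel)"
    unfolding weak_integrand_travelling[OF W]
    by (rule Bochner_Integration.integral_cong)
      (simp_all add: F_def f_def fx_def ft_def algebra_simps)
  also have "\<dots> = - (\<integral>\<xi>. W \<xi> * (ft \<xi> + c * fx \<xi>) \<partial>lborel) + (\<integral>\<xi>. F \<xi> * fx \<xi> \<partial>lborel)
      + (\<integral>\<xi>. convolve K' W \<xi> * f \<xi> \<partial>lborel)"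
    using int by simp
  also have "(\<integral>\<xi>. F \<xi> * fx \<xi> \<partial>lborel) = shock_defect c W * f 0 - (\<integral>\<xi>. F' \<xi> * f \<xi> \<partial>lborel)"
    using parts by (simp add: shock_defect_def field_simps)
  finally have "(\<integral>x. weak_integrand (\<lambda>x t. W (x - c * t)) \<phi> x t \<partial>lborel)
      = - (\<integral>\<xi>. W \<xi> * (ft \<xi> + c * fx \<xi>) \<partial>lborel) + (shock_defect c W * f 0
        + ((\<integral>\<xi>. convolve K' W \<xi> * f \<xi> \<partial>lborel) - (\<integral>\<xi>. F' \<xi> * f \<xi> \<partial>lborel)))"
    by simp
  also have "(\<integral>\<xi>. convolve K' W \<xi> * f \<xi> \<partial>lborel) - (\<integral>\<xi>. F' \<xi> * f \<xi> \<partial>lborel)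
      = (\<integral>\<xi>. convolve K' W \<xi> * f \<xi> - F' \<xi> * f \<xi> \<partial>lborel)"
    using int by simp
  also have "\<dots> = (\<integral>\<xi>. residual c W \<xi> * f \<xi> \<partial>lborel)"
    by (rule Bochner_Integration.integral_cong) (simp_all add: F'_def residual_def algebra_simps)
  finally show ?thesis
    by (simp add: f_def fx_def ft_def \<psi>t_def)
qed

text \<open>
  Integrating the slices over \<open>t \<ge> 0\<close> shows that the weak equation holds up to the contribution of
  the shock defect and of the residual.
\<close>

lemma weak_form_travelling:
  assumes W: "profile_function W" and \<phi>: "test_function \<phi>"
  shows "(LINT t:{0..}|lebesgue. LINT x|lebesgue. weak_integrand (\<lambda>x t. W (x - c * t)) \<phi> x t)
    = (LINT x|lebesgue. W x * \<phi> (x, 0))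
      + (LBINT t:{0..}. shock_defect c W * \<phi> (c * t, t)
          + (\<integral>\<xi>. residual c W \<xi> * \<phi> (\<xi> + c * t, t) \<partial>lborel))"
proof -
  note Cc = test_function_Cc[OF \<phi>]
  define \<psi> where "\<psi> z = \<phi> (fst z + c * snd z, snd z)" for z
  define \<psi>t where "\<psi>t z = partial_t \<phi> (fst z + c * snd z, snd z) + c * partial_x \<phi> (fst z + c * snd z, snd z)" for z
  define A where "A t = (\<integral>\<xi>. W \<xi> * \<psi>t (\<xi>, t) \<partial>lborel)" for t
  define B where "B t = shock_defect c W * \<phi> (c * t, t)
    + (\<integral>\<xi>. residual c W \<xi> * \<phi> (\<xi> + c * t, t) \<partial>lborel)" for t
  have Cc\<psi>: "Cc \<psi>"
    unfolding \<psi>_def[abs_def] by (intro Cc_shear Cc)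
  have Cc\<psi>t: "Cc \<psi>t"
    unfolding \<psi>t_def[abs_def] by (intro Cc_add Cc_cmult Cc_shear Cc)
  have D: "((\<lambda>s. \<psi> (\<xi>, s)) has_field_derivative \<psi>t (\<xi>, t)) (at t)" for \<xi> t
  proof -
    have "((\<lambda>s. (\<xi> + c * s, s)) has_derivative (\<lambda>h. (c * h, h))) (at t)"
      by (auto intro!: derivative_eq_intros)
    from has_derivative_compose[OF this test_function_has_derivative[OF \<phi>]]
    show ?thesis
      unfolding has_field_derivative_def \<psi>_def \<psi>t_def fst_conv snd_conv
      by (rule has_derivative_eq_rhs) (auto simp: algebra_simps)
  qed
  have W_borel [measurable]: "W \<in> borel_measurable borel"
    using profile_measurable(1)[OF W] .
  have \<phi>_borel [measurable]: "\<phi> \<in> borel_measurable borel"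
    using Cc(1) by (intro borel_measurable_continuous_onI Cc_continuous)
  have slice: "(LINT x|lebesgue. weak_integrand (\<lambda>x t. W (x - c * t)) \<phi> x t) = - A t + B t" for t
  proof -
    have "(\<lambda>x. weak_integrand (\<lambda>x t. W (x - c * t)) \<phi> x t) \<in> borel_measurable borel"
    proof -
      have "(\<lambda>x. (x, t)) \<in> borel \<rightarrow>\<^sub>M (borel :: (real \<times> real) measure)"
        by (intro borel_measurable_continuous_onI continuous_intros)
      moreover have "(\<lambda>(x, t). weak_integrand (\<lambda>x t. W (x - c * t)) \<phi> x t) \<in> borel_measurable borel"
        using borel_measurable_integrable[OF integrable_weak_integrand[OF W \<phi>, of c]] by simp
      ultimately show ?thesis
        using measurable_compose[of "\<lambda>x. (x, t)" borel borel
            "\<lambda>(x, t). weak_integrand (\<lambda>x t. W (x - c * t)) \<phi> x t" borel]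
        by simp
    qed
    then show ?thesis
      unfolding A_def B_def \<psi>t_def using weak_integrand_slice[OF W \<phi>, of c t]
      by (simp add: integral_completion)
  qed
  have intA: "integrable lborel A"
    unfolding A_def[abs_def] by (intro integrable_time_slices profile_locally_bounded W Cc\<psi>t)
  have intB: "integrable lborel B"
  proof -
    have "Cc (\<lambda>t. \<phi> (c * t, t))"
      using Cc_section_snd[OF Cc\<psi>, of 0] by (simp add: \<psi>_def)
    from integrable_weight_line[OF locally_bounded_const this]
    have "integrable lborel (\<lambda>t. shock_defect c W * \<phi> (c * t, t))" .
    moreover have "integrable lborel (\<lambda>t. \<integral>\<xi>. residual c W \<xi> * \<phi> (\<xi> + c * t, t) \<partial>lborel)"
      using integrable_time_slices[OF residual_locally_bounded[OF W, of c] Cc\<psi>] by (simp add: \<psi>_def)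
    ultimately show ?thesis
      unfolding B_def[abs_def] by (rule Bochner_Integration.integrable_add)
  qed
  have set_int: "set_integrable lborel {0..} A" "set_integrable lborel {0..} B"
    using integrable_mult_indicator[OF _ intA] integrable_mult_indicator[OF _ intB]
    by (simp_all add: set_integrable_def)
  have "(LINT t:{0..}|lebesgue. LINT x|lebesgue. weak_integrand (\<lambda>x t. W (x - c * t)) \<phi> x t)
      = (LINT t:{0..}|lebesgue. - A t + B t)"
    by (simp add: slice)
  also have "\<dots> = (LBINT t:{0..}. - A t + B t)"
    unfolding set_lebesgue_integral_def
    using borel_measurable_integrable[OF intA] borel_measurable_integrable[OF intB]
    by (intro integral_completion) simp
  also have "\<dots> = - (LBINT t:{0..}. A t) + (LBINT t:{0..}. B t)"
    using set_int by (simp add: set_integral_add)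
  also have "(LBINT t:{0..}. A t) = - (\<integral>\<xi>. W \<xi> * \<phi> (\<xi>, 0) \<partial>lborel)"
    using time_integral_initial_value[OF profile_locally_bounded[OF W] Cc\<psi> Cc\<psi>t D]
    by (simp add: A_def \<psi>_def)
  also have "(\<integral>\<xi>. W \<xi> * \<phi> (\<xi>, 0) \<partial>lborel) = (LINT x|lebesgue. W x * \<phi> (x, 0))"
  proof -
    have "integrable lborel (\<lambda>x. W x * \<phi> (x, 0))"
      by (intro integrable_weight_line profile_locally_bounded[OF W] Cc_section_fst Cc)
    from borel_measurable_integrable[OF this] show ?thesis
      by (simp add: integral_completion)
  qed
  finally show ?thesis
    by (simp add: B_def)
qed

lemma travelling_wave_Linf_loc:
  assumes W: "profile_function W"
  shows "(\<lambda>(x, t). W (x - c * t)) \<in> Linf_loc S"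
proof -
  obtain M where M: "\<And>\<xi>. \<bar>W \<xi>\<bar> \<le> M"
    using profile_bounded[OF W] by blast
  have "(\<lambda>z::real \<times> real. fst z - c * snd z) \<in> borel_measurable borel"
    by (intro borel_measurable_continuous_onI continuous_intros)
  then have "(\<lambda>z. W (fst z - c * snd z)) \<in> borel_measurable borel"
    using profile_measurable(1)[OF W] by (rule measurable_compose)
  then have "(\<lambda>z. W (fst z - c * snd z)) \<in> borel_measurable (lebesgue_on S)"
    by (intro measurable_restrict_space1 measurable_completion) simp
  with M show ?thesis
    by (auto simp: Linf_loc_def case_prod_beta)
qed

lemma profile_Linf_loc:
  assumes W: "profile_function W"
  shows "W \<in> Linf_loc S"
proof -
  obtain M where M: "\<And>\<xi>. \<bar>W \<xi>\<bar> \<le> M"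
    using profile_bounded[OF W] by blast
  have "W \<in> borel_measurable (lebesgue_on S)"
    using profile_measurable(1)[OF W] by (intro measurable_restrict_space1 measurable_completion) simp
  with M show ?thesis
    by (auto simp: Linf_loc_def)
qed

text \<open>
  The qualitative requirements on a weak solution (local boundedness, existence of the convolution,
  integrability of the integrand) hold for every profile, so only the integral identity remains.
\<close>

lemma weak_solution_iff_defects:
  assumes W: "profile_function W"
  shows "weak_solution (\<lambda>x t. W (x - c * t)) W \<longleftrightarrow>
    (\<forall>\<phi>. test_function \<phi> \<longrightarrow> (LBINT t:{0..}. shock_defect c W * \<phi> (c * t, t)
        + (\<integral>\<xi>. residual c W \<xi> * \<phi> (\<xi> + c * t, t) \<partial>lborel)) = 0)"
proof -
  obtain M where M: "\<And>\<xi>. \<bar>W \<xi>\<bar> \<le> M"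
    using profile_bounded[OF W] by blast
  have "convolution_exists K' (\<lambda>y. W (y - c * t)) x" for x t
    using profile_measurable(1)[OF W] M by (intro convolution_exists_bounded) auto
  moreover have "set_integrable lebesgue (UNIV \<times> {0..})
      (\<lambda>(x, t). weak_integrand (\<lambda>x t. W (x - c * t)) \<phi> x t)" if "test_function \<phi>" for \<phi>
  proof -
    note int = integrable_weak_integrand[OF W that, of c]
    from int have "integrable lebesgue (\<lambda>(x, t). weak_integrand (\<lambda>x t. W (x - c * t)) \<phi> x t)"
      using integrable_completion[OF borel_measurable_integrable[OF int]] by blast
    then show ?thesis
      unfolding set_integrable_def
      by (intro integrable_mult_indicator sets_completionI_sets) (simp_all add: borel_closed closed_Times)
  qed
  ultimately show ?thesis
    unfolding weak_solution_def
    using travelling_wave_Linf_loc[OF W] profile_Linf_loc[OF W] weak_form_travelling[OF W]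
    by auto
qed

section \<open>Localisation with bump functions\<close>

lemma integral_pos_on_interval:
  fixes f :: "real \<Rightarrow> real"
  assumes int: "integrable lborel f" and "l < r"
    and pos: "\<And>x. l < x \<Longrightarrow> x < r \<Longrightarrow> f x > 0" and zero: "\<And>x. x \<le> l \<or> r \<le> x \<Longrightarrow> f x = 0"
  shows "(\<integral>x. f x \<partial>lborel) > 0"
proof -
  have nonneg: "f x \<ge> 0" for x
    using pos[of x] zero[of x] by fastforce
  have "(\<integral>x. f x \<partial>lborel) \<noteq> 0"
  proof
    assume "(\<integral>x. f x \<partial>lborel) = 0"
    then have "AE x in lborel. f x = 0"
      using integral_nonneg_eq_0_iff_AE[OF int] nonneg by simp
    then have "AE x in lborel. x \<notin> {l<..<r}"
      by eventually_elim (use pos in force)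
    moreover have "{x \<in> space lborel. \<not> x \<notin> {l<..<r}} = {l<..<r}"
      by auto
    ultimately have "emeasure lborel {l<..<r} = 0"
      by (subst (asm) AE_iff_measurable) simp_all
    with \<open>l < r\<close> show False
      by simp
  qed
  moreover have "(\<integral>x. f x \<partial>lborel) \<ge> 0"
    using nonneg by simp
  ultimately show ?thesis
    by simp
qed

lemma bump_Cc: "Cc (bump l r)"
proof -
  have "{x. bump l r x \<noteq> 0} \<subseteq> {l..r}"
    by (auto simp: bump_eq_0_iff)
  then have "bounded {x. bump l r x \<noteq> 0}"
    using bounded_closed_interval bounded_subset by blast
  then show ?thesis
    by (simp add: Cc_def continuous_on_bump)
qed

text \<open>
  For a separated test function, the time integral is a positive factor. It is positive already for
  the bump on \<open>(0, 1)\<close>, which lives inside the time half line.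
\<close>

lemma weak_solution_bump:
  assumes W: "profile_function W" and sol: "weak_solution (\<lambda>x t. W (x - c * t)) W"
  shows "shock_defect c W * bump l r 0 + (\<integral>\<xi>. residual c W \<xi> * bump l r \<xi> \<partial>lborel) = 0"
    (is "?k = 0")
proof -
  have "(LBINT t:{0..}. shock_defect c W * (bump l r 0 * bump 0 1 t)
      + (\<integral>\<xi>. residual c W \<xi> * (bump l r \<xi> * bump 0 1 t) \<partial>lborel)) = 0"
    using sol[unfolded weak_solution_iff_defects[OF W], rule_format,
        OF test_function_travelling_bump[of l r c 0 1]] by simp
  moreover have "shock_defect c W * (bump l r 0 * bump 0 1 t)
      + (\<integral>\<xi>. residual c W \<xi> * (bump l r \<xi> * bump 0 1 t) \<partial>lborel) = ?k * bump 0 1 t" for t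
    by (simp add: distrib_right mult.assoc[symmetric])
  ultimately have "(LBINT t:{0..}. ?k * bump 0 1 t) = 0"
    by simp
  moreover have "(LBINT t:{0..}. ?k * bump 0 1 t) = (\<integral>t. ?k * bump 0 1 t \<partial>lborel)"
    unfolding set_lebesgue_integral_def
    by (rule Bochner_Integration.integral_cong) (auto simp: indicator_def bump_eq_0_iff)
  moreover have "(\<integral>t. bump 0 1 t \<partial>lborel) > 0"
    using integrable_weight_line[OF locally_bounded_const[of 1] bump_Cc[of 0 1]]
    by (intro integral_pos_on_interval[of _ 0 1]) (auto simp: bump_pos_iff bump_eq_0_iff)
  ultimately show ?thesis
    by auto
qed

theorem theorem2p2:
  fixes c :: real and W :: "real \<Rightarrow> real"
  assumes "profile_function W"
    and "lim_left0 W \<noteq> lim_right0 W"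
  shows "weak_solution (\<lambda>x t. W (x - c * t)) W \<longleftrightarrow>
           lim_right0 W + lim_left0 W = 2 * c \<and>
           (\<forall>\<xi>. \<xi> \<noteq> 0 \<longrightarrow> (W \<xi> - c) * deriv W \<xi> + convolve K' W \<xi> = 0)"
proof -
  have defect: "lim_right0 W + lim_left0 W = 2 * c \<longleftrightarrow> shock_defect c W = 0"
    using assms(2) by (auto simp: shock_defect_def)
  have null: "(\<integral>\<xi>. residual c W \<xi> * f \<xi> \<partial>lborel) = 0"
    if "\<forall>\<xi>. \<xi> \<noteq> 0 \<longrightarrow> residual c W \<xi> = 0" for f :: "real \<Rightarrow> real"
    using that by (intro integral_eq_zero_AE AE_mp[OF AE_lborel_singleton[of 0] AE_I2]) simp
  have "weak_solution (\<lambda>x t. W (x - c * t)) W \<longleftrightarrow>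
      shock_defect c W = 0 \<and> (\<forall>\<xi>. \<xi> \<noteq> 0 \<longrightarrow> residual c W \<xi> = 0)"
  proof (intro iffI conjI)
    assume "shock_defect c W = 0 \<and> (\<forall>\<xi>. \<xi> \<noteq> 0 \<longrightarrow> residual c W \<xi> = 0)"
    then show "weak_solution (\<lambda>x t. W (x - c * t)) W"
      unfolding weak_solution_iff_defects[OF assms(1)]
      using null by (simp add: set_lebesgue_integral_def)
  next
    assume sol: "weak_solution (\<lambda>x t. W (x - c * t)) W"
    note test = weak_solution_bump[OF assms(1) sol]
    show res: "\<forall>\<xi>. \<xi> \<noteq> 0 \<longrightarrow> residual c W \<xi> = 0"
    proof (intro allI impI, rule ccontr)
      fix \<xi>0 :: real assume "\<xi>0 \<noteq> 0" and nz: "residual c W \<xi>0 \<noteq> 0"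
      \<comment> \<open>The sign \<open>s\<close> treats positive and negative residuals at once.\<close>
      define s where "s = sgn (residual c W \<xi>0)"
      have "isCont (\<lambda>\<xi>. s * residual c W \<xi>) \<xi>0"
        by (intro isCont_mult continuous_const residual_isCont[OF assms(1)] \<open>\<xi>0 \<noteq> 0\<close>)
      moreover have s_pos: "s * residual c W \<xi>0 > 0"
        using nz by (simp add: s_def sgn_if)
      ultimately have "\<forall>\<^sub>F \<xi> in at \<xi>0. s * residual c W \<xi> > 0"
        unfolding isCont_def by (rule order_tendstoD(1))
      then obtain d where d: "d > 0" "\<And>\<xi>. \<xi> \<noteq> \<xi>0 \<Longrightarrow> dist \<xi> \<xi>0 < d \<Longrightarrow> s * residual c W \<xi> > 0"
        unfolding eventually_at by blast
      \<comment> \<open>The radius stays below \<open>\<bar>\<xi>0\<bar>\<close>, so that the bump vanishes at \<open>0\<close> and the shock drops out.\<close>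
      define e where "e = min d \<bar>\<xi>0\<bar>"
      have e: "e > 0" "e \<le> d" "e \<le> \<bar>\<xi>0\<bar>"
        using d(1) \<open>\<xi>0 \<noteq> 0\<close> by (auto simp: e_def)
      let ?b = "bump (\<xi>0 - e) (\<xi>0 + e)"
      have "(\<integral>\<xi>. s * (residual c W \<xi> * ?b \<xi>) \<partial>lborel) > 0"
      proof (rule integral_pos_on_interval[of _ "\<xi>0 - e" "\<xi>0 + e"])
        show "integrable lborel (\<lambda>\<xi>. s * (residual c W \<xi> * ?b \<xi>))"
          by (intro integrable_mult_right integrable_weight_line residual_locally_bounded assms bump_Cc)
        fix \<xi> assume \<xi>: "\<xi>0 - e < \<xi>" "\<xi> < \<xi>0 + e"
        have "s * residual c W \<xi> > 0"
        proof (cases "\<xi> = \<xi>0")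
          case True
          then show ?thesis using s_pos by simp
        next
          case False
          then show ?thesis using \<xi> e by (intro d(2)) (auto simp: dist_real_def)
        qed
        moreover have "?b \<xi> > 0"
          using \<xi> by (simp add: bump_pos_iff)
        ultimately have "(s * residual c W \<xi>) * ?b \<xi> > 0"
          by (rule mult_pos_pos)
        then show "s * (residual c W \<xi> * ?b \<xi>) > 0"
          by (simp only: mult.assoc)
      next
        fix \<xi> assume "\<xi> \<le> \<xi>0 - e \<or> \<xi>0 + e \<le> \<xi>"
        then have "?b \<xi> = 0"
          by (simp add: bump_eq_0_iff)
        then show "s * (residual c W \<xi> * ?b \<xi>) = 0"
          by simp
      qed (use e in simp)
      moreover have "?b 0 = 0"
        using e by (auto simp: bump_eq_0_iff)
      then have "(\<integral>\<xi>. residual c W \<xi> * ?b \<xi> \<partial>lborel) = 0"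
        using test[of "\<xi>0 - e" "\<xi>0 + e"] by simp
      ultimately show False
        by simp
    qed
    have "bump (-1) 1 0 > 0"
      by (simp add: bump_pos_iff)
    then show "shock_defect c W = 0"
      using test[of "-1" 1] null[OF res] by simp
  qed
  then show ?thesis
    unfolding defect residual_def .
qed

end
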